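(* Let $(G,\tau,\oplus)$ be a locally compact topological gyrogroup which is an $NSS$-gyrogroup. Then $G$ is first-countable.
   Context: A gyrogroup is a nonempty set $G$ with a binary operation $\oplus$ such that: (G1) there is a unique identity element $0\in G$ with $0\oplus a=a=a\oplus 0$ for all $a\in G$; (G2) for each $x\in G$ there is a unique inverse $\ominus x\in G$ with $\ominus x\oplus x=0=x\oplus(\ominus x)$; (G3) for all $x,y\in G$ there is an automorphism $gyr[x,y]$ of $(G,\oplus)$ (a bijective homomorphism of $(G,\oplus)$ onto itself) such that $x\oplus(y\oplus z)=(x\oplus y)\oplus gyr[x,y](z)$ for all $z\in G$; (G4) $gyr[x\oplus y,y]=gyr[x,y]$ for all $x,y\in G$. A topological gyrogroup $(G,\tau,\oplus)$ is a gyrogroup $(G,\oplus)$ with a topology $\tau$ such that $\oplus:G\times G\to G$ is jointly continuous and $x\mapsto\ominus x$ is continuous. All topological gyrogroups are assumed to be $T_1$ spaces. A subgyrogroup of $G$ is a nonempty subset $H\subset G$ such that $\ominus x\in H$ and $x\oplus y\in H$ for all $x,y\in H$. A topological gyrogroup $G$ is an $NSS$-gyrogroup (no small subgyrogroups) if there is a neighborhood $V$ of $0$ such that every subgyrogroup $H$ of $G$ contained in $V$ is trivial, i.e. $H=\{0\}$. *)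

theory Defs
  imports "HOL-Analysis.Analysis"
begin

text \<open>
  A gyrogroup on a carrier set \<open>G\<close>. The identity, the inversion and the gyrations
  are parameters of the locale; the axioms determine them on \<open>G\<close>, so quantifying universally over
  them is the same as asserting their existence. All axioms are relativised to \<open>G\<close>; in particular
  \<open>gyr_loop\<close> is equality of gyrations as maps on \<open>G\<close>.
\<close>

locale gyrogroup =
  fixes G :: "'a set"
    and gyroplus :: "'a \<Rightarrow> 'a \<Rightarrow> 'a" (infixl \<open>\<oplus>\<close> 65)
    and gyrozero :: 'a (\<open>\<zero>\<close>)
    and gyrominus :: "'a \<Rightarrow> 'a" (\<open>\<ominus> _\<close> [81] 80)
    and gyr :: "'a \<Rightarrow> 'a \<Rightarrow> 'a \<Rightarrow> 'a"
  assumes plus_closed: "\<lbrakk>x \<in> G; y \<in> G\<rbrakk> \<Longrightarrow> x \<oplus> y \<in> G"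
    and zero_closed: "\<zero> \<in> G"
    and zero_neutral: "a \<in> G \<Longrightarrow> \<zero> \<oplus> a = a \<and> a \<oplus> \<zero> = a"
    and zero_unique: "\<lbrakk>e \<in> G; \<And>a. a \<in> G \<Longrightarrow> e \<oplus> a = a \<and> a \<oplus> e = a\<rbrakk> \<Longrightarrow> e = \<zero>"
    and minus_closed: "x \<in> G \<Longrightarrow> \<ominus> x \<in> G"
    and minus_inverse: "x \<in> G \<Longrightarrow> (\<ominus> x) \<oplus> x = \<zero> \<and> x \<oplus> (\<ominus> x) = \<zero>"
    and minus_unique: "\<lbrakk>x \<in> G; y \<in> G; y \<oplus> x = \<zero>; x \<oplus> y = \<zero>\<rbrakk> \<Longrightarrow> y = \<ominus> x"
    and gyr_bij: "\<lbrakk>x \<in> G; y \<in> G\<rbrakk> \<Longrightarrow> bij_betw (gyr x y) G G"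
    and gyr_hom: "\<lbrakk>x \<in> G; y \<in> G; a \<in> G; b \<in> G\<rbrakk> \<Longrightarrow> gyr x y (a \<oplus> b) = gyr x y a \<oplus> gyr x y b"
    and gyr_assoc: "\<lbrakk>x \<in> G; y \<in> G; z \<in> G\<rbrakk> \<Longrightarrow> x \<oplus> (y \<oplus> z) = (x \<oplus> y) \<oplus> gyr x y z"
    and gyr_loop: "\<lbrakk>x \<in> G; y \<in> G; z \<in> G\<rbrakk> \<Longrightarrow> gyr (x \<oplus> y) y z = gyr x y z"

text \<open>
  The \<open>T\<^sub>1\<close> axiom is not part of this locale; it is a separate hypothesis where it is needed.
\<close>

locale topological_gyrogroup = gyrogroup G gyroplus gyrozero gyrominus gyr
  for G :: "'a set"
    and gyroplus :: "'a \<Rightarrow> 'a \<Rightarrow> 'a" (infixl \<open>\<oplus>\<close> 65)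
    and gyrozero :: 'a (\<open>\<zero>\<close>)
    and gyrominus :: "'a \<Rightarrow> 'a" (\<open>\<ominus> _\<close> [81] 80)
    and gyr :: "'a \<Rightarrow> 'a \<Rightarrow> 'a \<Rightarrow> 'a" +
  fixes T :: "'a topology"
  assumes topspace_eq: "topspace T = G"
    and continuous_plus: "continuous_map (prod_topology T T) T (\<lambda>(x, y). x \<oplus> y)"
    and continuous_minus: "continuous_map T T gyrominus"

definition subgyrogroup ::
    "'a set \<Rightarrow> ('a \<Rightarrow> 'a \<Rightarrow> 'a) \<Rightarrow> ('a \<Rightarrow> 'a) \<Rightarrow> 'a set \<Rightarrow> bool"
  where "subgyrogroup G gplus gminus H \<longleftrightarrow>
    H \<noteq> {} \<and> H \<subseteq> G \<and> (\<forall>x\<in>H. gminus x \<in> H) \<and> (\<forall>x\<in>H. \<forall>y\<in>H. gplus x y \<in> H)"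

text \<open>Neighbourhoods need not be open.\<close>

definition NSS_gyrogroup ::
    "'a set \<Rightarrow> ('a \<Rightarrow> 'a \<Rightarrow> 'a) \<Rightarrow> 'a \<Rightarrow> ('a \<Rightarrow> 'a) \<Rightarrow> 'a topology \<Rightarrow> bool"
  where "NSS_gyrogroup G gplus gzero gminus T \<longleftrightarrow>
    (\<exists>V. V \<subseteq> G \<and> (\<exists>U. openin T U \<and> gzero \<in> U \<and> U \<subseteq> V) \<and>
         (\<forall>H. subgyrogroup G gplus gminus H \<and> H \<subseteq> V \<longrightarrow> H = {gzero}))"

end

theory Submission
  imports Defs
begin

text \<open>
  Since \<open>a = b\<close> iff \<open>\<ominus> a \<oplus> b = \<zero>\<close>, a \<open>T\<^sub>1\<close> topological gyrogroup is Hausdorff, and a locally compact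
  one is therefore regular. Start from an open \<open>U\<^sub>0\<close> around \<open>\<zero>\<close> that lies in a compact set and
  contains no nontrivial subgyrogroup, and choose open \<open>U\<^sub>n\<^sub>+\<^sub>1\<close> around \<open>\<zero>\<close> with closure,
  inverses and pairwise sums in \<open>U\<^sub>n\<close>. The intersection of the \<open>U\<^sub>n\<close>, which is also that of
  their closures, is a subgyrogroup, hence \<open>{\<zero>}\<close>; by compactness the \<open>U\<^sub>n\<close> form a base at \<open>\<zero>\<close>.
  Left translations are homeomorphisms and carry this base to every other point.
\<close>

text \<open>\<open>W\<close> and the complements of the \<open>C n\<close> form an open cover of
  \<open>K\<close>. A finite subcover uses finitely many complements, and as \<open>C\<close>
  decreases the complement with the largest index absorbs the others.\<close>

lemma compactin_decseq_closed_subset_open: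
  assumes K: "compactin X K" and C: "\<And>n. closedin X (C n)" and dec: "decseq C"
    and sub: "K \<inter> (\<Inter>n::nat. C n) \<subseteq> W" and W: "openin X W"
  shows "\<exists>n. K \<inter> C n \<subseteq> W"
proof -
  let ?\<U> = "insert W (range (\<lambda>n. topspace X - C n))"
  have "K \<subseteq> topspace X"
    using K by (simp add: compactin_subset_topspace)
  then have "K \<subseteq> \<Union>?\<U>"
    using sub by auto
  moreover have "\<forall>U\<in>?\<U>. openin X U"
    using C W by auto
  ultimately obtain \<F> where \<F>: "finite \<F>" "\<F> \<subseteq> ?\<U>" "K \<subseteq> \<Union>\<F>"
    using K unfolding compactin_def by meson
  then have "finite (\<F> - {W})" "\<F> - {W} \<subseteq> range (\<lambda>n. topspace X - C n)"
    by auto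
  then obtain N where N: "finite N" "\<F> - {W} = (\<lambda>n. topspace X - C n) ` N"
    by (meson finite_subset_image)
  obtain m where m: "\<And>n. n \<in> N \<Longrightarrow> n \<le> m"
    using N(1) by (meson finite_nat_set_iff_bounded_le)
  have "x \<in> W" if x: "x \<in> K" "x \<in> C m" for x
  proof (rule ccontr)
    assume "x \<notin> W"
    then obtain n where "n \<in> N" "x \<notin> C n"
      using \<F>(3) N(2) x(1) by blast
    then show False
      using decseqD[OF dec m] x(2) by blast
  qed
  then show ?thesis
    by blast
qed

context gyrogroup
begin

text \<open>Adding \<open>\<ominus> x\<close> on the left turns \<open>x \<oplus> c\<close> into
  \<open>gyr (\<ominus> x) x c\<close>, and gyrations are injective on \<open>G\<close>.\<close>

lemma left_cancel:
  assumes "x \<in> G" "a \<in> G" "b \<in> G" "x \<oplus> a = x \<oplus> b"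
  shows "a = b"
proof -
  have x': "\<ominus> x \<in> G"
    using assms(1) by (rule minus_closed)
  have bij: "bij_betw (gyr (\<ominus> x) x) G G"
    using x' assms(1) by (rule gyr_bij)
  have "\<ominus> x \<oplus> (x \<oplus> c) = gyr (\<ominus> x) x c" if "c \<in> G" for c
  proof -
    have "gyr (\<ominus> x) x c \<in> G"
      using bij that by (rule bij_betw_apply)
    then show ?thesis
      using gyr_assoc[OF x' assms(1) that] minus_inverse[OF assms(1)] zero_neutral by simp
  qed
  then have "gyr (\<ominus> x) x a = gyr (\<ominus> x) x b"
    using assms by metis
  with bij_betw_imp_inj_on[OF bij] show ?thesis
    using assms(2,3) by (rule inj_onD)
qed

lemma gyr_zero_left:
  assumes "x \<in> G" "z \<in> G"
  shows "gyr \<zero> x z = z"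
proof -
  have "gyr \<zero> x z \<in> G"
    using assms gyr_bij zero_closed by (meson bij_betwE)
  moreover have "x \<oplus> gyr \<zero> x z = x \<oplus> z"
    using gyr_assoc[OF zero_closed assms] zero_neutral[OF assms(1)]
      zero_neutral[OF plus_closed[OF assms]] by simp
  ultimately show ?thesis
    using assms left_cancel by blast
qed

text \<open>The gyration left over by \<open>gyr_assoc\<close> is trivial. This identity makes the
  translation by \<open>\<ominus> x\<close> a right inverse of the translation by
  \<open>x\<close>.\<close>

lemma plus_minus_cancel:
  assumes "x \<in> G" "y \<in> G"
  shows "x \<oplus> (\<ominus> x \<oplus> y) = y"
proof -
  have x': "\<ominus> x \<in> G"
    using assms(1) by (rule minus_closed)
  \<comment> \<open>The loop property replaces \<open>gyr x (\<ominus> x)\<close> by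
    \<open>gyr (x \<oplus> \<ominus> x) (\<ominus> x)\<close>, which is
    \<open>gyr \<zero> (\<ominus> x)\<close>, the identity on \<open>G\<close>.\<close>
  have "gyr x (\<ominus> x) y = y"
    using gyr_loop[OF assms(1) x' assms(2)] minus_inverse[OF assms(1)] gyr_zero_left[OF x' assms(2)]
    by simp
  then show ?thesis
    using gyr_assoc[OF assms(1) x' assms(2)] minus_inverse[OF assms(1)] zero_neutral[OF assms(2)]
    by simp
qed

lemma minus_plus_eq_zero_iff:
  assumes "x \<in> G" "y \<in> G"
  shows "\<ominus> x \<oplus> y = \<zero> \<longleftrightarrow> x = y"
  using plus_minus_cancel[OF assms] minus_inverse[OF assms(2)] zero_neutral[OF assms(1)] by auto

end

context topological_gyrogroup
begin

lemma continuous_map_gyroplus: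
  assumes "continuous_map X T f" "continuous_map X T g"
  shows "continuous_map X T (\<lambda>x. f x \<oplus> g x)"
  using continuous_map_compose[OF continuous_map_pairedI[OF assms] continuous_plus]
  by (simp add: o_def)

lemma continuous_map_gyrominus:
  assumes "continuous_map X T f"
  shows "continuous_map X T (\<lambda>x. \<ominus> f x)"
  using continuous_map_compose[OF assms continuous_minus] by (simp add: o_def)

lemma continuous_map_left_translation:
  assumes "x \<in> G"
  shows "continuous_map T T ((\<oplus>) x)"
  using continuous_map_gyroplus[of T "\<lambda>_. x" "\<lambda>y. y"] assms topspace_eq by auto

text \<open>The diagonal is the preimage of the closed set \<open>{\<zero>}\<close> under the
  continuous map taking \<open>(x, y)\<close> to \<open>\<ominus> x \<oplus> y\<close>, hence
  closed.\<close>

lemma t1_imp_Hausdorff_space: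
  assumes "t1_space T"
  shows "Hausdorff_space T"
proof -
  have "continuous_map (prod_topology T T) T (\<lambda>p. \<ominus> fst p \<oplus> snd p)"
    by (intro continuous_map_gyroplus continuous_map_gyrominus continuous_map_fst continuous_map_snd)
  moreover have "closedin T {\<zero>}"
    using assms topspace_eq zero_closed by (simp add: closedin_t1_singleton)
  ultimately have "closedin (prod_topology T T)
      {p \<in> topspace (prod_topology T T). \<ominus> fst p \<oplus> snd p \<in> {\<zero>}}"
    by (rule closedin_continuous_map_preimage)
  moreover have "{p \<in> topspace (prod_topology T T). \<ominus> fst p \<oplus> snd p \<in> {\<zero>}}
      = (\<lambda>x. (x, x)) ` topspace T"
    by (simp add: set_eq_iff image_iff topspace_eq minus_plus_eq_zero_iff cong: conj_cong) auto
  ultimately show ?thesis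
    by (simp add: Hausdorff_space_closedin_diagonal)
qed

lemma regular_shrink_neighbourhood:
  assumes "regular_space T" "openin T U" "\<zero> \<in> U"
  shows "\<exists>W. openin T W \<and> \<zero> \<in> W \<and> T closure_of W \<subseteq> U \<and>
           (\<forall>x\<in>W. \<ominus> x \<in> U) \<and> (\<forall>x\<in>W. \<forall>y\<in>W. x \<oplus> y \<in> U)"
proof -
  have zz: "\<zero> \<oplus> \<zero> = \<zero>" and mz: "\<ominus> \<zero> = \<zero>"
    using zero_neutral[OF zero_closed] minus_inverse[OF zero_closed]
      zero_neutral[OF minus_closed[OF zero_closed]] by auto
  \<comment> \<open>Regularity, read as a neighbourhood base of closed sets. Any subset of
    \<open>R\<close> has its closure inside \<open>C\<close>, hence inside \<open>U\<close>.\<close>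
  obtain R C where R: "openin T R" "closedin T C" "\<zero> \<in> R" "R \<subseteq> C" "C \<subseteq> U"
    using assms unfolding neighbourhood_base_of_closedin[symmetric] neighbourhood_base_of
    by meson
  have "openin (prod_topology T T)
      {p \<in> topspace (prod_topology T T). (case p of (x, y) \<Rightarrow> x \<oplus> y) \<in> U}"
    using continuous_plus assms(2) by (rule openin_continuous_map_preimage)
  moreover have "(\<zero>, \<zero>) \<in> {p \<in> topspace (prod_topology T T). (case p of (x, y) \<Rightarrow> x \<oplus> y) \<in> U}"
    using zero_closed topspace_eq zz assms(3) by auto
  \<comment> \<open>Continuity of the sum at \<open>(\<zero>, \<zero>)\<close> gives a box;
    \<open>A \<inter> B\<close> then serves for both summands.\<close>
  ultimately obtain A B where AB: "openin T A" "openin T B" "\<zero> \<in> A" "\<zero> \<in> B"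
      "A \<times> B \<subseteq> {p \<in> topspace (prod_topology T T). (case p of (x, y) \<Rightarrow> x \<oplus> y) \<in> U}"
    unfolding openin_prod_topology_alt by meson
  define M where "M = {x \<in> topspace T. \<ominus> x \<in> U}"
  have M: "openin T M"
    unfolding M_def using continuous_minus assms(2) by (rule openin_continuous_map_preimage)
  have "openin T (R \<inter> M \<inter> (A \<inter> B))"
    using R AB M by (intro openin_Int)
  moreover have "\<zero> \<in> R \<inter> M \<inter> (A \<inter> B)"
    using R AB mz assms(3) zero_closed topspace_eq by (auto simp: M_def)
  moreover have "T closure_of (R \<inter> M \<inter> (A \<inter> B)) \<subseteq> U"
    using R closure_of_minimal[of "R \<inter> M \<inter> (A \<inter> B)" C T] by blast
  moreover have "\<forall>x\<in>R \<inter> M \<inter> (A \<inter> B). \<ominus> x \<in> U"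
    by (auto simp: M_def)
  moreover have "\<forall>x\<in>R \<inter> M \<inter> (A \<inter> B). \<forall>y\<in>R \<inter> M \<inter> (A \<inter> B). x \<oplus> y \<in> U"
    using AB(5) by auto
  ultimately show ?thesis
    by blast
qed

lemma NSS_countable_base_at_zero:
  assumes reg: "regular_space T" and lc: "locally_compact_space T"
    and nss: "NSS_gyrogroup G (\<oplus>) \<zero> gyrominus T"
  obtains U :: "nat \<Rightarrow> 'a set" where "\<And>n. openin T (U n)" "\<And>n. \<zero> \<in> U n"
    "\<And>W. openin T W \<Longrightarrow> \<zero> \<in> W \<Longrightarrow> \<exists>n. U n \<subseteq> W"
proof -
  obtain V U1 where V: "openin T U1" "\<zero> \<in> U1" "U1 \<subseteq> V"
      "\<And>H. subgyrogroup G (\<oplus>) gyrominus H \<Longrightarrow> H \<subseteq> V \<Longrightarrow> H = {\<zero>}"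
    using nss unfolding NSS_gyrogroup_def by blast
  obtain U2 K where K: "openin T U2" "compactin T K" "\<zero> \<in> U2" "U2 \<subseteq> K"
    using lc zero_closed topspace_eq unfolding locally_compact_space_def by blast
  \<comment> \<open>Staying in \<open>U1\<close> lets the NSS property apply to the intersection of
    the sequence; staying in \<open>U2\<close> keeps every member inside the compact set
    \<open>K\<close>.\<close>
  let ?P = "\<lambda>W. openin T W \<and> \<zero> \<in> W \<and> W \<subseteq> U1 \<inter> U2"
  let ?Q = "\<lambda>U W. T closure_of W \<subseteq> U \<and> (\<forall>x\<in>W. \<ominus> x \<in> U) \<and> (\<forall>x\<in>W. \<forall>y\<in>W. x \<oplus> y \<in> U)"
  have "\<exists>W. ?P W"
    using V K by (intro exI[of _ "U1 \<inter> U2"]) auto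
  moreover have "\<exists>W. ?P W \<and> ?Q U W" if U: "?P U" for U
  proof -
    have "openin T U" "\<zero> \<in> U"
      using U by simp_all
    from regular_shrink_neighbourhood[OF reg this]
    obtain W where W: "openin T W \<and> \<zero> \<in> W \<and> ?Q U W" ..
    then have "W \<subseteq> T closure_of W"
      by (simp add: closure_of_subset openin_subset)
    then have "W \<subseteq> U1 \<inter> U2"
      using U W by (meson subset_trans)
    with W show ?thesis
      by (intro exI[of _ W]) simp
  qed
  ultimately have "\<exists>U. \<forall>n. ?P (U n) \<and> ?Q (U n) (U (Suc n))"
    by (rule dependent_nat_choice)
  then obtain U where U: "\<forall>n. ?P (U n) \<and> ?Q (U n) (U (Suc n))" ..
  then have P: "?P (U n)" and closure_U: "T closure_of U (Suc n) \<subseteq> U n"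
    and minus_U: "x \<in> U (Suc n) \<Longrightarrow> \<ominus> x \<in> U n"
    and plus_U: "x \<in> U (Suc n) \<Longrightarrow> y \<in> U (Suc n) \<Longrightarrow> x \<oplus> y \<in> U n" for n x y
    by simp_all
  have open_U: "openin T (U n)" and zero_U: "\<zero> \<in> U n" for n
    using P by auto
  have U_closure: "U n \<subseteq> T closure_of U n" for n
    using open_U by (simp add: closure_of_subset openin_subset)
  have "subgyrogroup G (\<oplus>) gyrominus (\<Inter>n. U n)"
    unfolding subgyrogroup_def
  proof (intro conjI ballI)
    have "\<zero> \<in> (\<Inter>n. U n)"
      using zero_U by simp
    then show "(\<Inter>n. U n) \<noteq> {}"
      by blast
    show "(\<Inter>n. U n) \<subseteq> G"
      using openin_subset[OF open_U[of 0]] by (auto simp: topspace_eq)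
    \<comment> \<open>One index is lost at each operation, which is harmless in the intersection:
      membership in every \<open>U (Suc n)\<close> yields a result in every
      \<open>U n\<close>.\<close>
    show "\<ominus> x \<in> (\<Inter>n. U n)" if "x \<in> (\<Inter>n. U n)" for x
      using that by (intro INT_I minus_U) simp
    show "x \<oplus> y \<in> (\<Inter>n. U n)" if "x \<in> (\<Inter>n. U n)" "y \<in> (\<Inter>n. U n)" for x y
      using that by (intro INT_I plus_U) simp_all
  qed
  moreover have "(\<Inter>n. U n) \<subseteq> V"
    using P[of 0] V(3) by blast
  ultimately have "(\<Inter>n. U n) = {\<zero>}"
    by (rule V(4))
  then have closures: "(\<Inter>n. T closure_of U n) \<subseteq> {\<zero>}"
    using closure_U by blast
  have dec: "decseq (\<lambda>n. T closure_of U n)"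
    by (rule decseq_SucI) (rule subset_trans[OF closure_U U_closure])
  have "\<exists>n. U n \<subseteq> W" if W: "openin T W" "\<zero> \<in> W" for W
  proof -
    \<comment> \<open>The compactness lemma needs closed sets, hence the closures;
      \<open>U n\<close> lies both in its closure and in \<open>K\<close>.\<close>
    have "\<exists>n. K \<inter> T closure_of U n \<subseteq> W"
      using closures W
      by (intro compactin_decseq_closed_subset_open[OF K(2) closedin_closure_of dec]) auto
    moreover have "U n \<subseteq> K" for n
      using P K(4) by blast
    ultimately show ?thesis
      using U_closure by blast
  qed
  with open_U zero_U show thesis
    by (rule that)
qed

lemma first_countable_if_countable_base_at_zero:
  fixes U :: "nat \<Rightarrow> 'a set"
  assumes open_U: "\<And>n. openin T (U n)" and zero_U: "\<And>n. \<zero> \<in> U n"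
    and base: "\<And>W. openin T W \<Longrightarrow> \<zero> \<in> W \<Longrightarrow> \<exists>n. U n \<subseteq> W"
  shows "first_countable T"
  unfolding first_countable_def
proof
  fix x
  assume "x \<in> topspace T"
  then have x: "x \<in> G" "\<ominus> x \<in> G"
    by (simp_all add: topspace_eq minus_closed)
  \<comment> \<open>This is the translate of \<open>U n\<close> by \<open>x\<close>, written as a
    preimage so that continuity gives openness at once.\<close>
  define N where "N n = {y \<in> topspace T. \<ominus> x \<oplus> y \<in> U n}" for n
  have "openin T (N n)" for n
    unfolding N_def using continuous_map_left_translation[OF x(2)] open_U
    by (rule openin_continuous_map_preimage)
  moreover have "x \<in> N n" for n
    using x zero_U minus_inverse topspace_eq by (simp add: N_def)
  moreover have "\<exists>n. N n \<subseteq> W" if W: "openin T W" "x \<in> W" for W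
  proof -
    \<comment> \<open>Pulling \<open>W\<close> back by the translation gives an open set containing
      \<open>\<zero>\<close>, so some \<open>U n\<close> fits inside it. For \<open>y\<close> in
      \<open>N n\<close>, the identity \<open>y = x \<oplus> (\<ominus> x \<oplus> y)\<close> then
      puts \<open>y\<close> in \<open>W\<close>.\<close>
    have "openin T {y \<in> topspace T. x \<oplus> y \<in> W}"
      using continuous_map_left_translation[OF x(1)] W(1) by (rule openin_continuous_map_preimage)
    then obtain n where "U n \<subseteq> {y \<in> topspace T. x \<oplus> y \<in> W}"
      using base W(2) x zero_closed zero_neutral topspace_eq by fastforce
    then have "N n \<subseteq> W"
      using plus_minus_cancel[OF x(1)] topspace_eq by (fastforce simp: N_def)
    then show ?thesis ..
  qed
  ultimately show "\<exists>\<B>. countable \<B> \<and> (\<forall>V\<in>\<B>. openin T V) \<and>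
      (\<forall>W. openin T W \<and> x \<in> W \<longrightarrow> (\<exists>V\<in>\<B>. x \<in> V \<and> V \<subseteq> W))"
    by (intro exI[of _ "range N"]) auto
qed

end

theorem theorem4p4:
  fixes G :: "'a set"
    and gplus :: "'a \<Rightarrow> 'a \<Rightarrow> 'a"
    and gzero :: 'a
    and gminus :: "'a \<Rightarrow> 'a"
    and gyr :: "'a \<Rightarrow> 'a \<Rightarrow> 'a \<Rightarrow> 'a"
    and T :: "'a topology"
  assumes "topological_gyrogroup G gplus gzero gminus gyr T"
    and "t1_space T"
    and "locally_compact_space T"
    and "NSS_gyrogroup G gplus gzero gminus T"
  shows "first_countable T"
proof -
  interpret topological_gyrogroup G gplus gzero gminus gyr T
    by (rule assms(1))
  have "regular_space T"
    using assms(2,3) t1_imp_Hausdorff_space locally_compact_Hausdorff_imp_regular_space by blast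
  from NSS_countable_base_at_zero[OF this assms(3,4)] show ?thesis
    using first_countable_if_countable_base_at_zero by blast
qed

end
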